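(* Let $\Theta$ be the given linear time-varying system and let $\mathcal{G}_I=(\mathcal{V},\mathcal{E}_I)$ be the given information graph. For an information graph $\mathcal{G}$ on $\mathcal V$, let $J^*(\mathcal{G})$ denote the optimal value of the decentralized control design problem with information graph $\mathcal{G}$, and let $\mathrm{PN}(\Theta)$ denote the set of information graphs that are partially nested with respect to $\Theta$. Consider the optimization problem over directed graphs $\mathcal G$ on $\mathcal V$: $$\underset{\mathcal{G}\supseteq \mathcal{G}_I}{\text{maximize}}\quad J^*(\mathcal{G})\qquad\text{subject to}\quad \mathcal{G}\in \mathrm{PN}(\Theta).$$ Then an optimal solution of this problem is $\overline{\mathcal{G}_P(\Theta,\mathcal{G}_I)}$, the transitive closure of the precedence graph associated with $\Theta$ and $\mathcal{G}_I$. That is, $\overline{\mathcal{G}_P(\Theta,\mathcal{G}_I)}\supseteq\mathcal G_I$, $\overline{\mathcal{G}_P(\Theta,\mathcal{G}_I)}\in \mathrm{PN}(\Theta)$, and $J^*(\mathcal G)\le J^*\big(\overline{\mathcal{G}_P(\Theta,\mathcal{G}_I)}\big)$ for every $\mathcal G\supseteq \mathcal G_I$ with $\mathcal G\in \mathrm{PN}(\Theta)$.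
   Context: **System.** There are $N$ subsystems, $\mathcal V=\{1,\dots,N\}$, and a horizon $T$. The state $x(t)\in\mathbb R^{n_x}$, input $u(t)\in\mathbb R^{n_u}$, output $y(t)\in\mathbb R^{n_y}$ are concatenations of local states $x_i(t)\in\mathbb R^{n_x^i}$, local inputs $u_i(t)\in\mathbb R^{n_u^i}$, local outputs $y_i(t)\in\mathbb R^{n_y^i}$, $i\in\mathcal V$. The dynamics are $x(t+1)=A(t)x(t)+B(t)u(t)+G(t)\xi(t)$, $y(t)=C(t)x(t)+H(t)\xi(t)$, $t=0,\dots,T-1$, with real matrices, fixed known $x(0)$, and disturbance $\xi(t)\in\mathbb R^{n_\xi}$. Write $\Theta=\{A(t),B(t),G(t),C(t),H(t)\}_{t=0}^{T-1}$. For $s<t$ let $A_s^t=A(t-1)A(t-2)\cdots A(s)$, and $A_t^t=I$. The matrix $C(t)A_{s+1}^tB(s)$ is viewed as an $N\times N$ block matrix whose $(k,j)$ block $[\,\cdot\,]_{kj}$ has size $n_y^k\times n_u^j$. Standing assumption on $\Theta$: for each $i\in\mathcal V$ there exist $0\le s<t\le T-1$ with $[C(t)A_{s+1}^tB(s)]_{ii}\neq0$. **Trajectories.** $x=(x(0),\dots,x(T))\in\mathbb R^{N_x}$, $u=(u(0),\dots,u(T-1))\in\mathbb R^{N_u}$, $\xi=(1,\xi(0),\dots,\xi(T-1))\in\mathbb R^{N_\xi}$, $y=(1,y(0),\dots,y(T-1))\in\mathbb R^{N_y}$. The dynamics read $x=Bu+G\xi$, $y=Cx+H\xi$, where (block indices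 starting at $0$): $B$ has block $(t,s)$ equal to $A_{s+1}^tB(s)$ for $0\le s<t\le T$ and $0$ otherwise; $G$ has first column with blocks $A_0^tx(0)$, $0\le t\le T$, and, in the columns multiplying $\xi(s)$, blocks $A_{s+1}^tG(s)$ for $s<t$ and $0$ otherwise; $C$ has first row (one scalar row) zero and the row block for $y(t)$ equal to $C(t)$ in the columns of $x(t)$ and $0$ elsewhere; $H=\mathrm{diag}(1,H(0),\dots,H(T-1))$. **Disturbance.** $\xi$ is a random vector with law $\mathbb P$ on $(\mathbb R^{N_\xi},\mathcal B(\mathbb R^{N_\xi}))$, and $\mathcal L^2_m$ is the space of square-integrable random vectors on this space with values in $\mathbb R^m$. $\xi$ is elliptically contoured: there are $\mu\in\mathbb R^{N_\xi}$, a positive semidefinite $\Sigma$, and a scalar function $g$ such that the characteristic function of $\xi-\mu$ is $\theta\mapsto g(\theta^{\sf T}\Sigma\theta)$. The support of $\xi$ is an ellipsoid with nonempty relative interior in the hyperplane $\{\xi:\xi_1=1\}$, of the form $\Xi=\{\xi\in\mathbb R^{N_\xi}: \xi_1=1,\ W\xi\in\mathcal K_2\}$ with $W\in\mathbb R^{N_\xi\times N_\xi}$ and $\mathcal K_2=\{v: v_1\ge\sqrt{v_2^2+\cdots+v_n^2}\}$; $M=\mathbb E[\xi\xi^{\sf T}]$ is positive definite and finite. **Information graphs and policies.** An information graph is a directed graph $\mathcal G=(\mathcal V,\mathcal E)$ with $(i,i)\in\mathcal E$ for all $i\in\mathcal V$. The local information of subsystem $i$ at time $t$ is $z_i(t)=\{y_j^t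 : (j,i)\in\mathcal E\}$, where $y_j^t=(y_j(0),\dots,y_j(t))$; inclusions between sets $z_i(t)$ are inclusions of these collections of labeled output histories. $\Gamma(\mathcal G)$ is the set of decentralized policies $\gamma$ with $u_i(t)=\gamma_i(z_i(t),t)$, where each $\gamma_i(\cdot,t)$ is a measurable function; write $u=\gamma(y)$. **Decentralized control design problem for $\mathcal G$.** With data $R_x,R_u$ symmetric positive semidefinite and $F_x\in\mathbb R^{m\times N_x}$, $F_u\in\mathbb R^{m\times N_u}$, $F_\xi\in\mathbb R^{m\times N_\xi}$: minimize $\mathbb E[x^{\sf T}R_xx+u^{\sf T}R_uu]$ over $\gamma\in\Gamma(\mathcal G)$, $s\in\mathcal L^2_m$, subject to $F_xx+F_uu+F_\xi\xi+s=0$, $x=Bu+G\xi$, $y=Cx+H\xi$, $u=\gamma(y)$, $s\ge0$, all $\mathbb P$-almost surely. $J^*(\mathcal G)$ is its optimal value (infimum, $+\infty$ if infeasible). **Precedence and partial nestedness.** Given an information graph $\mathcal G=(\mathcal V,\mathcal E)$, $j\prec i$ ($j$ is a precedent to $i$ with respect to $(\Theta,\mathcal G)$) if there exist $0\le s<t\le T-1$ and $k$ with $(k,i)\in\mathcal E$ such that $[C(t)A_{s+1}^tB(s)]_{kj}\ne0$. The precedence graph $\mathcal G_P(\Theta,\mathcal G)$ has node set $\mathcal V$ and edge set $\{(i,j): i\prec j \text{ with respect to }(\Theta,\mathcal G)\}$. $\mathcal G$ is partially nested with respect to $\Theta$ if $j\prec i$ implies $z_j(t)\subseteq z_i(t)$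 for all $t=0,\dots,T-1$. The transitive closure $\overline{\mathcal G}$ of a directed graph has an edge $(i,j)$ iff there is a directed path from $i$ to $j$ in $\mathcal G$. $\mathcal G\supseteq\mathcal G'$ for graphs on $\mathcal V$ means containment of edge sets. *)

theory Defs
  imports "HOL-Probability.Probability" "Jordan_Normal_Form.Matrix"
begin

unbundle no inner_syntax
unbundle no vec_syntax

text \<open>Vectors and matrices are those of \<^theory>\<open>Jordan_Normal_Form.Matrix\<close>, whose dimensions are
  natural numbers and whose indices start at 0. Thus the component \<open>\<xi>\<^sub>1\<close> is \<open>\<xi> $ 0\<close>.
  Subsystems and time steps are natural numbers; subsystems range over \<open>{1..N}\<close>.\<close>


section \<open>Vectors, block matrices, and the Borel sigma-algebra\<close>

definition subvec :: "nat \<Rightarrow> nat \<Rightarrow> real vec \<Rightarrow> real vec" where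
  "subvec k n v = Matrix.vec n (\<lambda>a. v $ (k + a))"

text \<open>Position of the first entry of block \<open>i\<close> in a concatenation of blocks of sizes \<open>d 1, d 2, \<dots>\<close>.\<close>

definition offset :: "(nat \<Rightarrow> nat) \<Rightarrow> nat \<Rightarrow> nat" where
  "offset d i = (\<Sum>j\<in>{1..<i}. d j)"

text \<open>The \<open>p \<times> q\<close> block matrix with blocks \<open>F t s\<close> (block indices from 0) of size \<open>m \<times> n\<close>.\<close>

definition block_mat :: "nat \<Rightarrow> nat \<Rightarrow> nat \<Rightarrow> nat \<Rightarrow> (nat \<Rightarrow> nat \<Rightarrow> real mat) \<Rightarrow> real mat" where
  "block_mat p q m n F =
     mat (p * m) (q * n) (\<lambda>(r, c). F (r div m) (c div n) $$ (r mod m, c mod n))"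

definition psd_mat :: "nat \<Rightarrow> real mat \<Rightarrow> bool" where
  "psd_mat n R \<longleftrightarrow> R \<in> carrier_mat n n \<and> transpose_mat R = R \<and>
     (\<forall>v \<in> carrier_vec n. v \<bullet> (R *\<^sub>v v) \<ge> 0)"

definition pd_mat :: "nat \<Rightarrow> real mat \<Rightarrow> bool" where
  "pd_mat n R \<longleftrightarrow> R \<in> carrier_mat n n \<and> transpose_mat R = R \<and>
     (\<forall>v \<in> carrier_vec n. v \<noteq> 0\<^sub>v n \<longrightarrow> v \<bullet> (R *\<^sub>v v) > 0)"

definition eucl_norm :: "real vec \<Rightarrow> real" where
  "eucl_norm v = sqrt (v \<bullet> v)"

text \<open>The Borel sigma-algebra of \<open>\<real>\<^sup>n\<close>, transported to \<^term>\<open>carrier_vec n\<close>: it is generated by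
  the coordinate maps. (Only the sets of this measure space matter.)\<close>

definition borel_vec :: "nat \<Rightarrow> real vec measure" where
  "borel_vec n = vimage_algebra (carrier_vec n) (\<lambda>v. \<lambda>i\<in>{..<n}. v $ i) (\<Pi>\<^sub>M i\<in>{..<n}. borel)"

definition L2 :: "real vec measure \<Rightarrow> nat \<Rightarrow> (real vec \<Rightarrow> real vec) set" where
  "L2 P m = {s \<in> P \<rightarrow>\<^sub>M borel_vec m. integrable P (\<lambda>\<xi>. (eucl_norm (s \<xi>))\<^sup>2)}"


section \<open>The linear time-varying system\<close>

record ltv_system =
  num_sub :: nat
  horizon :: nat
  xdim :: "nat \<Rightarrow> nat"
  udim :: "nat \<Rightarrow> nat"
  ydim :: "nat \<Rightarrow> nat"
  n\<xi> :: nat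
  A_mat :: "nat \<Rightarrow> real mat"
  B_mat :: "nat \<Rightarrow> real mat"
  G_mat :: "nat \<Rightarrow> real mat"
  C_mat :: "nat \<Rightarrow> real mat"
  H_mat :: "nat \<Rightarrow> real mat"

definition nodes :: "ltv_system \<Rightarrow> nat set" where
  "nodes \<Theta> = {1..num_sub \<Theta>}"

definition nx :: "ltv_system \<Rightarrow> nat" where
  "nx \<Theta> = (\<Sum>i\<in>nodes \<Theta>. xdim \<Theta> i)"

definition nu :: "ltv_system \<Rightarrow> nat" where
  "nu \<Theta> = (\<Sum>i\<in>nodes \<Theta>. udim \<Theta> i)"

definition ny :: "ltv_system \<Rightarrow> nat" where
  "ny \<Theta> = (\<Sum>i\<in>nodes \<Theta>. ydim \<Theta> i)"

definition Nx :: "ltv_system \<Rightarrow> nat" where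
  "Nx \<Theta> = (horizon \<Theta> + 1) * nx \<Theta>"

definition Nu :: "ltv_system \<Rightarrow> nat" where
  "Nu \<Theta> = horizon \<Theta> * nu \<Theta>"

definition N\<xi> :: "ltv_system \<Rightarrow> nat" where
  "N\<xi> \<Theta> = 1 + horizon \<Theta> * n\<xi> \<Theta>"

definition Ny :: "ltv_system \<Rightarrow> nat" where
  "Ny \<Theta> = 1 + horizon \<Theta> * ny \<Theta>"

definition wf_system :: "ltv_system \<Rightarrow> bool" where
  "wf_system \<Theta> \<longleftrightarrow> (\<forall>t < horizon \<Theta>.
     A_mat \<Theta> t \<in> carrier_mat (nx \<Theta>) (nx \<Theta>) \<and>
     B_mat \<Theta> t \<in> carrier_mat (nx \<Theta>) (nu \<Theta>) \<and>
     G_mat \<Theta> t \<in> carrier_mat (nx \<Theta>) (n\<xi> \<Theta>) \<and>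
     C_mat \<Theta> t \<in> carrier_mat (ny \<Theta>) (nx \<Theta>) \<and>
     H_mat \<Theta> t \<in> carrier_mat (ny \<Theta>) (n\<xi> \<Theta>))"

text \<open>\<open>A\<^sub>s\<^sup>t = A(t-1) \<cdots> A(s)\<close>, and the identity for \<open>t \<le> s\<close>.\<close>

primrec A_prod :: "ltv_system \<Rightarrow> nat \<Rightarrow> nat \<Rightarrow> real mat" where
  "A_prod \<Theta> s 0 = 1\<^sub>m (nx \<Theta>)"
| "A_prod \<Theta> s (Suc t) = (if s \<le> t then A_mat \<Theta> t * A_prod \<Theta> s t else 1\<^sub>m (nx \<Theta>))"

text \<open>The block \<open>[C(t) A\<^sub>s\<^sub>+\<^sub>1\<^sup>t B(s)]\<^sub>k\<^sub>j\<close>, of size \<open>ydim k \<times> udim j\<close>.\<close>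

definition io_block :: "ltv_system \<Rightarrow> nat \<Rightarrow> nat \<Rightarrow> nat \<Rightarrow> nat \<Rightarrow> real mat" where
  "io_block \<Theta> t s k j = mat (ydim \<Theta> k) (udim \<Theta> j)
     (\<lambda>(a, b). (C_mat \<Theta> t * A_prod \<Theta> (s + 1) t * B_mat \<Theta> s)
        $$ (offset (ydim \<Theta>) k + a, offset (udim \<Theta>) j + b))"

definition io_nonzero :: "ltv_system \<Rightarrow> nat \<Rightarrow> nat \<Rightarrow> nat \<Rightarrow> nat \<Rightarrow> bool" where
  "io_nonzero \<Theta> t s k j \<longleftrightarrow> io_block \<Theta> t s k j \<noteq> 0\<^sub>m (ydim \<Theta> k) (udim \<Theta> j)"

definition standing_assumption :: "ltv_system \<Rightarrow> bool" where
  "standing_assumption \<Theta> \<longleftrightarrow>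
     (\<forall>i \<in> nodes \<Theta>. \<exists>s t. s < t \<and> t < horizon \<Theta> \<and> io_nonzero \<Theta> t s i i)"


section \<open>Trajectories\<close>

text \<open>Stacked matrices in \<open>x = B u + G \<xi>\<close> and \<open>y = C x + H \<xi>\<close>, where \<open>x = (x(0), \<dots>, x(T))\<close>,
  \<open>u = (u(0), \<dots>, u(T-1))\<close>, \<open>\<xi> = (1, \<xi>(0), \<dots>, \<xi>(T-1))\<close> and \<open>y = (1, y(0), \<dots>, y(T-1))\<close>.\<close>

definition B_traj :: "ltv_system \<Rightarrow> real mat" where
  "B_traj \<Theta> = block_mat (horizon \<Theta> + 1) (horizon \<Theta>) (nx \<Theta>) (nu \<Theta>)
     (\<lambda>t s. if s < t then A_prod \<Theta> (s + 1) t * B_mat \<Theta> s else 0\<^sub>m (nx \<Theta>) (nu \<Theta>))"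

definition G_traj :: "ltv_system \<Rightarrow> real vec \<Rightarrow> real mat" where
  "G_traj \<Theta> x0 = four_block_mat
     (mat (Nx \<Theta>) 1 (\<lambda>(r, c). (A_prod \<Theta> 0 (r div nx \<Theta>) *\<^sub>v x0) $ (r mod nx \<Theta>)))
     (block_mat (horizon \<Theta> + 1) (horizon \<Theta>) (nx \<Theta>) (n\<xi> \<Theta>)
        (\<lambda>t s. if s < t then A_prod \<Theta> (s + 1) t * G_mat \<Theta> s else 0\<^sub>m (nx \<Theta>) (n\<xi> \<Theta>)))
     (0\<^sub>m 0 1)
     (0\<^sub>m 0 (horizon \<Theta> * n\<xi> \<Theta>))"

definition C_traj :: "ltv_system \<Rightarrow> real mat" where
  "C_traj \<Theta> = 0\<^sub>m 1 (Nx \<Theta>) @\<^sub>r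
     block_mat (horizon \<Theta>) (horizon \<Theta> + 1) (ny \<Theta>) (nx \<Theta>)
       (\<lambda>t s. if s = t then C_mat \<Theta> t else 0\<^sub>m (ny \<Theta>) (nx \<Theta>))"

definition H_traj :: "ltv_system \<Rightarrow> real mat" where
  "H_traj \<Theta> = diag_block_mat (1\<^sub>m 1 # map (H_mat \<Theta>) [0..<horizon \<Theta>])"

text \<open>\<open>u\<^sub>i(t)\<close> and \<open>y\<^sub>i(t)\<close> as parts of the trajectories \<open>u\<close> and \<open>y\<close>.\<close>

definition local_input :: "ltv_system \<Rightarrow> real vec \<Rightarrow> nat \<Rightarrow> nat \<Rightarrow> real vec" where
  "local_input \<Theta> u i t = subvec (t * nu \<Theta> + offset (udim \<Theta>) i) (udim \<Theta> i) u"

definition local_output :: "ltv_system \<Rightarrow> real vec \<Rightarrow> nat \<Rightarrow> nat \<Rightarrow> real vec" where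
  "local_output \<Theta> y i t = subvec (1 + t * ny \<Theta> + offset (ydim \<Theta>) i) (ydim \<Theta> i) y"

definition output_history :: "ltv_system \<Rightarrow> real vec \<Rightarrow> nat \<Rightarrow> nat \<Rightarrow> (nat \<Rightarrow> real vec)" where
  "output_history \<Theta> y j t = (\<lambda>\<tau>\<in>{..t}. local_output \<Theta> y j \<tau>)"


section \<open>Information graphs, precedence and partial nestedness\<close>

text \<open>The node set of every graph is \<^const>\<open>nodes\<close>, so a graph is given by its edge set.\<close>

definition information_graph :: "ltv_system \<Rightarrow> nat rel \<Rightarrow> bool" where
  "information_graph \<Theta> E \<longleftrightarrow> E \<subseteq> nodes \<Theta> \<times> nodes \<Theta> \<and> (\<forall>i \<in> nodes \<Theta>. (i, i) \<in> E)"

definition in_neighbors :: "nat rel \<Rightarrow> nat \<Rightarrow> nat set" where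
  "in_neighbors E i = {j. (j, i) \<in> E}"

text \<open>The local information \<open>z\<^sub>i(t)\<close>, once as the collection of labeled output histories
  \<open>(j, y\<^sub>j\<^sup>t)\<close>, and once as the function \<open>j \<mapsto> y\<^sub>j\<^sup>t\<close> having this collection as its graph. The
  latter form is the argument of the policies.\<close>

definition info_set :: "ltv_system \<Rightarrow> nat rel \<Rightarrow> real vec \<Rightarrow> nat \<Rightarrow> nat \<Rightarrow> (nat \<times> (nat \<Rightarrow> real vec)) set" where
  "info_set \<Theta> E y i t = {(j, output_history \<Theta> y j t) | j. j \<in> in_neighbors E i}"

definition info_fun :: "ltv_system \<Rightarrow> nat rel \<Rightarrow> real vec \<Rightarrow> nat \<Rightarrow> nat \<Rightarrow> (nat \<Rightarrow> nat \<Rightarrow> real vec)" where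
  "info_fun \<Theta> E y i t = (\<lambda>j\<in>in_neighbors E i. output_history \<Theta> y j t)"

definition info_space :: "ltv_system \<Rightarrow> nat rel \<Rightarrow> nat \<Rightarrow> nat \<Rightarrow> (nat \<Rightarrow> nat \<Rightarrow> real vec) measure" where
  "info_space \<Theta> E i t = (\<Pi>\<^sub>M j\<in>in_neighbors E i. \<Pi>\<^sub>M \<tau>\<in>{..t}. borel_vec (ydim \<Theta> j))"

definition precedent :: "ltv_system \<Rightarrow> nat rel \<Rightarrow> nat \<Rightarrow> nat \<Rightarrow> bool" where
  "precedent \<Theta> E j i \<longleftrightarrow> j \<in> nodes \<Theta> \<and> i \<in> nodes \<Theta> \<and>
     (\<exists>s t k. s < t \<and> t < horizon \<Theta> \<and> k \<in> nodes \<Theta> \<and> (k, i) \<in> E \<and> io_nonzero \<Theta> t s k j)"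

definition precedence_graph :: "ltv_system \<Rightarrow> nat rel \<Rightarrow> nat rel" where
  "precedence_graph \<Theta> E = {(i, j). precedent \<Theta> E i j}"

definition partially_nested :: "ltv_system \<Rightarrow> nat rel \<Rightarrow> bool" where
  "partially_nested \<Theta> E \<longleftrightarrow> (\<forall>i j. precedent \<Theta> E j i \<longrightarrow>
     (\<forall>t < horizon \<Theta>. \<forall>y \<in> carrier_vec (Ny \<Theta>). info_set \<Theta> E y j t \<subseteq> info_set \<Theta> E y i t))"

definition PN :: "ltv_system \<Rightarrow> nat rel set" where
  "PN \<Theta> = {E. information_graph \<Theta> E \<and> partially_nested \<Theta> E}"

type_synonym policy = "nat \<Rightarrow> nat \<Rightarrow> (nat \<Rightarrow> nat \<Rightarrow> real vec) \<Rightarrow> real vec"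

definition policies :: "ltv_system \<Rightarrow> nat rel \<Rightarrow> policy set" where
  "policies \<Theta> E = {\<gamma>. \<forall>i \<in> nodes \<Theta>. \<forall>t < horizon \<Theta>.
     \<gamma> i t \<in> info_space \<Theta> E i t \<rightarrow>\<^sub>M borel_vec (udim \<Theta> i)}"

text \<open>The relation \<open>u = \<gamma>(y)\<close>.\<close>

definition generated_by :: "ltv_system \<Rightarrow> nat rel \<Rightarrow> policy \<Rightarrow> real vec \<Rightarrow> real vec \<Rightarrow> bool" where
  "generated_by \<Theta> E \<gamma> y u \<longleftrightarrow> (\<forall>i \<in> nodes \<Theta>. \<forall>t < horizon \<Theta>.
     local_input \<Theta> u i t = \<gamma> i t (info_fun \<Theta> E y i t))"


section \<open>The disturbance\<close>

definition elliptically_contoured :: "nat \<Rightarrow> real vec measure \<Rightarrow> bool" where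
  "elliptically_contoured n P \<longleftrightarrow>
     (\<exists>\<mu> \<Sigma> (g :: real \<Rightarrow> complex). \<mu> \<in> carrier_vec n \<and> psd_mat n \<Sigma> \<and>
        (\<forall>\<theta> \<in> carrier_vec n.
           (\<integral>\<xi>. iexp (\<theta> \<bullet> (\<xi> - \<mu>)) \<partial>P) = g (\<theta> \<bullet> (\<Sigma> *\<^sub>v \<theta>))))"

definition support :: "nat \<Rightarrow> real vec measure \<Rightarrow> real vec set" where
  "support n P = {x \<in> carrier_vec n.
     \<forall>\<epsilon> > 0. emeasure P {v \<in> carrier_vec n. eucl_norm (v - x) < \<epsilon>} > 0}"

text \<open>Affine images of closed Euclidean unit balls, possibly of lower dimension.\<close>

definition ellipsoid :: "nat \<Rightarrow> real vec set \<Rightarrow> bool" where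
  "ellipsoid n S \<longleftrightarrow> (\<exists>c \<in> carrier_vec n. \<exists>L \<in> carrier_mat n n.
     S = {c + L *\<^sub>v v | v. v \<in> carrier_vec n \<and> eucl_norm v \<le> 1})"

definition rel_interior_nonempty :: "nat \<Rightarrow> real vec set \<Rightarrow> bool" where
  "rel_interior_nonempty n S \<longleftrightarrow> (\<exists>x \<in> S. x $ 0 = 1 \<and> (\<exists>\<epsilon> > 0.
     \<forall>v \<in> carrier_vec n. v $ 0 = 1 \<and> eucl_norm (v - x) < \<epsilon> \<longrightarrow> v \<in> S))"

definition second_order_cone :: "nat \<Rightarrow> real vec set" where
  "second_order_cone n = {v \<in> carrier_vec n. v $ 0 \<ge> sqrt (\<Sum>i\<in>{1..<n}. (v $ i)\<^sup>2)}"

definition second_moment :: "nat \<Rightarrow> real vec measure \<Rightarrow> real mat" where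
  "second_moment n P = mat n n (\<lambda>(i, j). \<integral>\<xi>. \<xi> $ i * \<xi> $ j \<partial>P)"

definition disturbance_law :: "nat \<Rightarrow> real vec measure \<Rightarrow> bool" where
  "disturbance_law n P \<longleftrightarrow>
     prob_space P \<and> sets P = sets (borel_vec n) \<and>
     elliptically_contoured n P \<and>
     (\<exists>W \<in> carrier_mat n n.
        support n P = {\<xi> \<in> carrier_vec n. \<xi> $ 0 = 1 \<and> W *\<^sub>v \<xi> \<in> second_order_cone n}) \<and>
     ellipsoid n (support n P) \<and> rel_interior_nonempty n (support n P) \<and>
     (\<forall>i < n. \<forall>j < n. integrable P (\<lambda>\<xi>. \<xi> $ i * \<xi> $ j)) \<and>
     pd_mat n (second_moment n P)"


section \<open>The decentralized control design problem\<close>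

record design_data =
  init_state :: "real vec"
  law :: "real vec measure"
  Rx :: "real mat"
  Ru :: "real mat"
  num_constr :: nat
  Fx :: "real mat"
  Fu :: "real mat"
  F\<xi> :: "real mat"

definition wf_design :: "ltv_system \<Rightarrow> design_data \<Rightarrow> bool" where
  "wf_design \<Theta> D \<longleftrightarrow>
     init_state D \<in> carrier_vec (nx \<Theta>) \<and>
     disturbance_law (N\<xi> \<Theta>) (law D) \<and>
     psd_mat (Nx \<Theta>) (Rx D) \<and> psd_mat (Nu \<Theta>) (Ru D) \<and>
     Fx D \<in> carrier_mat (num_constr D) (Nx \<Theta>) \<and>
     Fu D \<in> carrier_mat (num_constr D) (Nu \<Theta>) \<and>
     F\<xi> D \<in> carrier_mat (num_constr D) (N\<xi> \<Theta>)"

text \<open>All random vectors are functions of the disturbance trajectory \<open>\<xi>\<close>, which is the sample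
  point of the probability space \<^const>\<open>law\<close>.\<close>

definition feasible ::
  "ltv_system \<Rightarrow> design_data \<Rightarrow> nat rel \<Rightarrow> policy \<Rightarrow> (real vec \<Rightarrow> real vec) \<Rightarrow>
   (real vec \<Rightarrow> real vec) \<Rightarrow> (real vec \<Rightarrow> real vec) \<Rightarrow> (real vec \<Rightarrow> real vec) \<Rightarrow> bool" where
  "feasible \<Theta> D E \<gamma> s x u y \<longleftrightarrow>
     \<gamma> \<in> policies \<Theta> E \<and> s \<in> L2 (law D) (num_constr D) \<and>
     x \<in> law D \<rightarrow>\<^sub>M borel_vec (Nx \<Theta>) \<and>
     u \<in> law D \<rightarrow>\<^sub>M borel_vec (Nu \<Theta>) \<and>
     y \<in> law D \<rightarrow>\<^sub>M borel_vec (Ny \<Theta>) \<and>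
     (AE \<xi> in law D.
        Fx D *\<^sub>v x \<xi> + Fu D *\<^sub>v u \<xi> + F\<xi> D *\<^sub>v \<xi> + s \<xi> = 0\<^sub>v (num_constr D) \<and>
        x \<xi> = B_traj \<Theta> *\<^sub>v u \<xi> + G_traj \<Theta> (init_state D) *\<^sub>v \<xi> \<and>
        y \<xi> = C_traj \<Theta> *\<^sub>v x \<xi> + H_traj \<Theta> *\<^sub>v \<xi> \<and>
        generated_by \<Theta> E \<gamma> (y \<xi>) (u \<xi>) \<and>
        0\<^sub>v (num_constr D) \<le> s \<xi>)"

text \<open>The cost is nonnegative because \<^const>\<open>Rx\<close> and \<^const>\<open>Ru\<close> are positive semidefinite, so the
  expectation is the Lebesgue integral with values in \<open>[0, \<infinity>]\<close>.\<close>

definition cost ::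
  "design_data \<Rightarrow> (real vec \<Rightarrow> real vec) \<Rightarrow> (real vec \<Rightarrow> real vec) \<Rightarrow> ennreal" where
  "cost D x u = (\<integral>\<^sup>+\<xi>. ennreal (x \<xi> \<bullet> (Rx D *\<^sub>v x \<xi>) + u \<xi> \<bullet> (Ru D *\<^sub>v u \<xi>)) \<partial>law D)"

text \<open>The infimum of the empty set is \<open>\<infinity>\<close>, the value of an infeasible problem.\<close>

definition opt_value :: "ltv_system \<Rightarrow> design_data \<Rightarrow> nat rel \<Rightarrow> ennreal" where
  "opt_value \<Theta> D E = Inf {cost D x u | \<gamma> s x u y. feasible \<Theta> D E \<gamma> s x u y}"

end

(* The standing assumption makes every edge of an information graph an edge of its precedence
   graph. A partially nested graph E containing E_I is therefore transitive and contains the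
   precedence graph of E_I, hence also its transitive closure, which is itself partially nested.
   So the closure is the least feasible graph. Finally, the optimal value is antitone in the graph,
   since a policy may ignore the additional information. *)

theory Submission
  imports Defs
begin

lemma information_graph_refl:
  "information_graph \<Theta> E \<Longrightarrow> i \<in> nodes \<Theta> \<Longrightarrow> (i, i) \<in> E"
  by (simp add: information_graph_def)

lemma precedence_graph_iff: "(j, i) \<in> precedence_graph \<Theta> E \<longleftrightarrow> precedent \<Theta> E j i"
  by (simp add: precedence_graph_def)

lemma precedent_mono: "E \<subseteq> E' \<Longrightarrow> precedent \<Theta> E j i \<Longrightarrow> precedent \<Theta> E' j i"
  unfolding precedent_def by blast

text \<open>The intermediate node \<open>k\<close> may be \<open>j\<close> itself: the standing
  assumption provides a nonzero diagonal block at \<open>j\<close>, and the edge from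
  \<open>j\<close> to \<open>i\<close> does the rest.\<close>

lemma edge_imp_precedent:
  assumes "standing_assumption \<Theta>" and "information_graph \<Theta> E" and "(j, i) \<in> E"
  shows "precedent \<Theta> E j i"
proof -
  have "j \<in> nodes \<Theta>" "i \<in> nodes \<Theta>"
    using assms(2,3) unfolding information_graph_def by auto
  then show ?thesis
    using assms(1,3) unfolding standing_assumption_def precedent_def by metis
qed

lemma information_graph_subset_precedence_graph:
  "standing_assumption \<Theta> \<Longrightarrow> information_graph \<Theta> E \<Longrightarrow> E \<subseteq> precedence_graph \<Theta> E"
  by (auto simp: precedence_graph_iff intro: edge_imp_precedent)

lemma trancl_precedence_graph_in_PN:
  assumes "standing_assumption \<Theta>" and E: "information_graph \<Theta> E"
  shows "(precedence_graph \<Theta> E)\<^sup>+ \<in> PN \<Theta>"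
proof -
  let ?P = "precedence_graph \<Theta> E"
  have "?P \<subseteq> nodes \<Theta> \<times> nodes \<Theta>"
    by (auto simp: precedence_graph_iff precedent_def)
  then have "?P\<^sup>+ \<subseteq> nodes \<Theta> \<times> nodes \<Theta>"
    by (rule trancl_subset_Sigma)
  moreover have "(i, i) \<in> ?P\<^sup>+" if "i \<in> nodes \<Theta>" for i
    using information_graph_subset_precedence_graph[OF assms] information_graph_refl[OF E that]
    by blast
  ultimately have graph: "information_graph \<Theta> (?P\<^sup>+)"
    by (simp add: information_graph_def)
  have "(j, i) \<in> ?P\<^sup>+" if "precedent \<Theta> (?P\<^sup>+) j i" for j i
  proof -
    from that obtain s t k where k: "j \<in> nodes \<Theta>" "k \<in> nodes \<Theta>" "(k, i) \<in> ?P\<^sup>+"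
      "s < t" "t < horizon \<Theta>" "io_nonzero \<Theta> t s k j"
      unfolding precedent_def by blast
    \<comment> \<open>The self-loop at \<open>k\<close> lets \<open>k\<close> be its own witness in
      \<open>E\<close>. So every precedent with respect to the closure is one precedence edge of
      \<open>E\<close> followed by a path, and taking the closure creates no precedence outside
      it.\<close>
    then have "precedent \<Theta> E j k"
      using information_graph_refl[OF E] unfolding precedent_def by blast
    then show ?thesis
      using k(3) by (meson precedence_graph_iff trancl_into_trancl2)
  qed
  \<comment> \<open>A path from \<open>j\<close> to \<open>i\<close> prolongs every path ending in
    \<open>j\<close>.\<close>
  then have "info_set \<Theta> (?P\<^sup>+) y j t \<subseteq> info_set \<Theta> (?P\<^sup>+) y i t"
    if "precedent \<Theta> (?P\<^sup>+) j i" for i j y t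
    using that unfolding info_set_def in_neighbors_def by (blast intro: trancl_trans)
  with graph show ?thesis
    unfolding PN_def partially_nested_def by blast
qed

text \<open>The labels on the output histories reveal the in-neighbors, so one output and one time
  suffice: the zero output and time 0, which lies within the horizon because a precedence needs some
  \<open>t < horizon \<Theta>\<close>.\<close>

lemma partially_nested_in_neighbors:
  assumes "partially_nested \<Theta> E" and "precedent \<Theta> E j i"
  shows "in_neighbors E j \<subseteq> in_neighbors E i"
proof -
  have "0 < horizon \<Theta>"
    using assms(2) unfolding precedent_def by auto
  then have "info_set \<Theta> E (0\<^sub>v (Ny \<Theta>)) j 0 \<subseteq> info_set \<Theta> E (0\<^sub>v (Ny \<Theta>)) i 0"
    using assms unfolding partially_nested_def by simp
  then show ?thesis
    unfolding info_set_def by blast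
qed

lemma trans_PN:
  assumes "standing_assumption \<Theta>" and "E \<in> PN \<Theta>"
  shows "trans E"
proof (rule transI)
  fix l j i assume "(l, j) \<in> E" "(j, i) \<in> E"
  moreover have "in_neighbors E j \<subseteq> in_neighbors E i"
    using assms \<open>(j, i) \<in> E\<close> edge_imp_precedent partially_nested_in_neighbors
    unfolding PN_def by blast
  ultimately show "(l, i) \<in> E"
    unfolding in_neighbors_def by blast
qed

lemma precedence_graph_subset_PN:
  assumes "E \<in> PN \<Theta>"
  shows "precedence_graph \<Theta> E \<subseteq> E"
proof (rule subrelI)
  fix j i assume "(j, i) \<in> precedence_graph \<Theta> E"
  then have prec: "precedent \<Theta> E j i"
    by (simp add: precedence_graph_iff)
  then have "in_neighbors E j \<subseteq> in_neighbors E i"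
    using assms partially_nested_in_neighbors unfolding PN_def by blast
  \<comment> \<open>By its self-loop \<open>j\<close> is among its own in-neighbors, hence among
    those of \<open>i\<close>.\<close>
  moreover have "(j, j) \<in> E"
    using assms prec information_graph_refl unfolding PN_def precedent_def by blast
  ultimately show "(j, i) \<in> E"
    unfolding in_neighbors_def by blast
qed

lemma trancl_precedence_graph_least:
  assumes "standing_assumption \<Theta>" and "E \<in> PN \<Theta>" and "E\<^sub>I \<subseteq> E"
  shows "(precedence_graph \<Theta> E\<^sub>I)\<^sup>+ \<subseteq> E"
proof -
  have "precedence_graph \<Theta> E\<^sub>I \<subseteq> precedence_graph \<Theta> E"
    using precedent_mono[OF assms(3)] by (auto simp: precedence_graph_iff)
  then have "precedence_graph \<Theta> E\<^sub>I \<subseteq> E"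
    using precedence_graph_subset_PN[OF assms(2)] by blast
  then have "(precedence_graph \<Theta> E\<^sub>I)\<^sup>+ \<subseteq> E\<^sup>+"
    by (auto intro: trancl_mono)
  then show ?thesis
    using trancl_id[OF trans_PN[OF assms(1,2)]] by simp
qed

definition restrict_info :: "nat rel \<Rightarrow> policy \<Rightarrow> policy" where
  "restrict_info E \<gamma> = (\<lambda>i t z. \<gamma> i t (restrict z (in_neighbors E i)))"

lemma restrict_info_policies:
  assumes "E \<subseteq> E'" and "\<gamma> \<in> policies \<Theta> E"
  shows "restrict_info E \<gamma> \<in> policies \<Theta> E'"
proof -
  have "restrict_info E \<gamma> i t \<in> info_space \<Theta> E' i t \<rightarrow>\<^sub>M borel_vec (udim \<Theta> i)"
    if "i \<in> nodes \<Theta>" "t < horizon \<Theta>" for i t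
  proof -
    have "in_neighbors E i \<subseteq> in_neighbors E' i"
      using assms(1) unfolding in_neighbors_def by blast
    then have "(\<lambda>z. restrict z (in_neighbors E i)) \<in> info_space \<Theta> E' i t \<rightarrow>\<^sub>M info_space \<Theta> E i t"
      unfolding info_space_def by (rule measurable_restrict_subset)
    moreover have "\<gamma> i t \<in> info_space \<Theta> E i t \<rightarrow>\<^sub>M borel_vec (udim \<Theta> i)"
      using assms(2) that unfolding policies_def by blast
    ultimately show ?thesis
      unfolding restrict_info_def by (rule measurable_compose)
  qed
  then show ?thesis
    unfolding policies_def by blast
qed

lemma generated_by_restrict_info:
  assumes "E \<subseteq> E'"
  shows "generated_by \<Theta> E' (restrict_info E \<gamma>) y u \<longleftrightarrow> generated_by \<Theta> E \<gamma> y u"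
proof -
  \<comment> \<open>\<open>info_fun\<close> is itself a restriction, so the two sides also agree
    outside \<open>in_neighbors E i\<close>.\<close>
  have "restrict (info_fun \<Theta> E' y i t) (in_neighbors E i) = info_fun \<Theta> E y i t" for i t
    using assms unfolding info_fun_def in_neighbors_def by (auto simp: restrict_def fun_eq_iff)
  then show ?thesis
    unfolding generated_by_def restrict_info_def by simp
qed

lemma opt_value_antimono:
  assumes "E \<subseteq> E'"
  shows "opt_value \<Theta> D E' \<le> opt_value \<Theta> D E"
proof -
  \<comment> \<open>Only the policy changes; \<open>s\<close>, \<open>x\<close>, \<open>u\<close>
    and \<open>y\<close> are kept, and the cost depends on \<open>x\<close> and \<open>u\<close>
    alone. Hence the larger graph attains at least the same costs.\<close>
  have "feasible \<Theta> D E' (restrict_info E \<gamma>) s x u y" if "feasible \<Theta> D E \<gamma> s x u y" for \<gamma> s x u y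
    using that restrict_info_policies[OF assms]
    unfolding feasible_def generated_by_restrict_info[OF assms] by blast
  then show ?thesis
    unfolding opt_value_def by (intro Inf_superset_mono) blast
qed

theorem theorem1:
  fixes \<Theta> :: ltv_system and D :: design_data and E\<^sub>I :: "nat rel"
  assumes "wf_system \<Theta>"
    and "standing_assumption \<Theta>"
    and "information_graph \<Theta> E\<^sub>I"
    and "wf_design \<Theta> D"
  shows "E\<^sub>I \<subseteq> (precedence_graph \<Theta> E\<^sub>I)\<^sup>+ \<and>
    (precedence_graph \<Theta> E\<^sub>I)\<^sup>+ \<in> PN \<Theta> \<and>
    (\<forall>E. E\<^sub>I \<subseteq> E \<and> E \<in> PN \<Theta> \<longrightarrow>
       opt_value \<Theta> D E \<le> opt_value \<Theta> D ((precedence_graph \<Theta> E\<^sub>I)\<^sup>+))"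
proof (intro conjI allI impI)
  show "E\<^sub>I \<subseteq> (precedence_graph \<Theta> E\<^sub>I)\<^sup>+"
    using information_graph_subset_precedence_graph[OF assms(2,3)] by (auto intro: r_into_trancl')
  show "(precedence_graph \<Theta> E\<^sub>I)\<^sup>+ \<in> PN \<Theta>"
    using assms(2,3) by (rule trancl_precedence_graph_in_PN)
  fix E assume "E\<^sub>I \<subseteq> E \<and> E \<in> PN \<Theta>"
  then show "opt_value \<Theta> D E \<le> opt_value \<Theta> D ((precedence_graph \<Theta> E\<^sub>I)\<^sup>+)"
    using trancl_precedence_graph_least[OF assms(2)] by (intro opt_value_antimono) blast
qed

end
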